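(* Let $n\ge 1$ be an integer and $I=[0,1]$. Whenever $C_1,\ldots,C_n\subset I^n$ are closed sets such that $C_i$ separates $I_i^-$ and $I_i^+$ for each $i\in\{1,\ldots,n\}$, then $\bigcap_{i=1}^n C_i\neq\emptyset$.
   Context: The cube $I^n=[0,1]^n$ carries its usual (Euclidean) topology. Its faces are, for $i\in\{1,\ldots,n\}$, $I_i^-=\{x\in I^n \mid x_i=0\}$ and $I_i^+=\{x\in I^n \mid x_i=1\}$. If $X$ is a topological space and $A,B,C\subset X$ are closed sets such that $X\setminus C=U\cup V$, where $U,V\subset X$ are disjoint open sets with $A\subset U$ and $B\subset V$, one says that $C$ separates $A$ and $B$ (here $X=I^n$). *)

theory Defs
  imports "HOL-Analysis.Analysis"
begin

definition unit_cube :: "(real ^ 'n) set" where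
  "unit_cube = {x. \<forall>i. x $ i \<in> {0..1}}"

definition neg_face :: "'n \<Rightarrow> (real ^ 'n) set" where
  "neg_face i = {x \<in> unit_cube. x $ i = 0}"

definition pos_face :: "'n \<Rightarrow> (real ^ 'n) set" where
  "pos_face i = {x \<in> unit_cube. x $ i = 1}"

definition separates_in :: "'a topology \<Rightarrow> 'a set \<Rightarrow> 'a set \<Rightarrow> 'a set \<Rightarrow> bool" where
  "separates_in X C A B \<longleftrightarrow>
     closedin X A \<and> closedin X B \<and> closedin X C \<and>
     (\<exists>U V. openin X U \<and> openin X V \<and> U \<inter> V = {} \<and>
            topspace X - C = U \<union> V \<and> A \<subseteq> U \<and> B \<subseteq> V)"

end

theory Submission
  imports Defs
begin

text \<open>
  Write the complement of \<open>C\<^sub>i\<close> in the cube as \<open>U\<^sub>i \<union> V\<^sub>i\<close> and let \<open>h\<^sub>i(x)\<close> be the distance from \<open>x\<close> to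
  the complement of \<open>U\<^sub>i\<close> minus its distance to the complement of \<open>V\<^sub>i\<close>. This continuous function is
  positive on \<open>U\<^sub>i\<close>, negative on \<open>V\<^sub>i\<close> and zero on \<open>C\<^sub>i\<close>. Since \<open>V\<^sub>i\<close> contains the face \<open>x\<^sub>i = 1\<close> and
  \<open>U\<^sub>i\<close> the face \<open>x\<^sub>i = 0\<close>, one has \<open>-x\<^sub>i \<le> h\<^sub>i(x) \<le> 1 - x\<^sub>i\<close>; so \<open>x \<mapsto> x + h(x)\<close> maps the cube to itself,
  and a fixed point given by Brouwer's theorem lies in every \<open>C\<^sub>i\<close>.
\<close>

lemma unit_cube_eq_cbox: "unit_cube = cbox 0 (1 :: real ^ 'n)"
  by (auto simp: unit_cube_def mem_box_cart)

text \<open>Replacing the \<open>i\<close>-th coordinate of \<open>x\<close> by \<open>c\<close>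
  gives a point of \<open>A\<close> at distance exactly
  \<open>\<bar>x $ i - c\<bar>\<close>.\<close>

lemma infdist_coordinate_slice_le:
  fixes x :: "real ^ 'n"
  assumes "x \<in> unit_cube" and "c \<in> {0..1}"
    and "{y \<in> unit_cube. y $ i = c} \<subseteq> A"
  shows "infdist x A \<le> \<bar>x $ i - c\<bar>"
proof -
  define y where "y = x - axis i (x $ i - c)"
  have "y $ j = (if j = i then c else x $ j)" for j
    by (simp add: y_def axis_def)
  then have "y \<in> A"
    using assms by (auto simp: unit_cube_def)
  then have "infdist x A \<le> dist x y"
    by (rule infdist_le)
  then show ?thesis
    by (simp add: y_def dist_norm norm_eq_sqrt_inner inner_axis_axis)
qed

text \<open>\<open>S - U\<close> is closed in \<open>S\<close> and misses \<open>x\<close>. It must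
  be nonempty because \<open>infdist x {}\<close> is 0 by convention.\<close>

lemma infdist_pos_if_openin:
  assumes "openin (top_of_set S) U" and "x \<in> U" and "S - U \<noteq> {}"
  shows "0 < infdist x (S - U)"
proof -
  have "U \<subseteq> S"
    using assms(1) by (rule openin_imp_subset)
  then show ?thesis
    using assms setdist_gt_0_closedin[of S "S - U" x]
    by (auto simp: infdist_eq_setdist openin_closedin_eq)
qed

theorem corollary4p2:
  fixes C :: "'n::finite \<Rightarrow> (real ^ 'n) set"
  assumes "\<And>i. closedin (top_of_set unit_cube) (C i)"
    and "\<And>i. separates_in (top_of_set unit_cube) (C i) (neg_face i) (pos_face i)"
  shows "(\<Inter>i\<in>UNIV. C i) \<noteq> {}"
proof -
  let ?Q = "unit_cube :: (real ^ 'n) set"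
  have "\<forall>i. \<exists>U V. openin (top_of_set ?Q) U \<and> openin (top_of_set ?Q) V \<and> U \<inter> V = {} \<and>
      ?Q - C i = U \<union> V \<and> neg_face i \<subseteq> U \<and> pos_face i \<subseteq> V"
    using assms(2) by (simp add: separates_in_def)
  then obtain U V where
        U: "\<And>i. openin (top_of_set ?Q) (U i)" and V: "\<And>i. openin (top_of_set ?Q) (V i)"
    and disj: "\<And>i. U i \<inter> V i = {}" and split: "\<And>i. ?Q - C i = U i \<union> V i"
    and neg: "\<And>i. neg_face i \<subseteq> U i" and pos: "\<And>i. pos_face i \<subseteq> V i"
    by metis
  have UV_subset: "U i \<subseteq> ?Q" "V i \<subseteq> ?Q" for i
    using split[of i] by auto
  \<comment> \<open>The face \<open>pos_face i\<close> lies in \<open>V i\<close>, hence outside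
    \<open>U i\<close>, so the slice bound applies with \<open>c = 1\<close>.\<close>
  have pos_le: "infdist x (?Q - U i) \<le> 1 - x $ i" if "x \<in> ?Q" for x i
  proof -
    have "infdist x (?Q - U i) \<le> \<bar>x $ i - 1\<bar>"
      by (rule infdist_coordinate_slice_le[OF that])
        (use pos[of i] disj[of i] in \<open>auto simp: pos_face_def\<close>)
    moreover have "x $ i \<le> 1"
      using that by (simp add: unit_cube_def)
    ultimately show ?thesis by simp
  qed
  have neg_le: "infdist x (?Q - V i) \<le> x $ i" if "x \<in> ?Q" for x i
  proof -
    have "infdist x (?Q - V i) \<le> \<bar>x $ i - 0\<bar>"
      by (rule infdist_coordinate_slice_le[OF that])
        (use neg[of i] disj[of i] in \<open>auto simp: neg_face_def\<close>)
    moreover have "0 \<le> x $ i"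
      using that by (simp add: unit_cube_def)
    ultimately show ?thesis by simp
  qed
  have compl_nonempty: "?Q - U i \<noteq> {}" "?Q - V i \<noteq> {}" for i
  proof -
    have "(1 :: real ^ 'n) \<in> pos_face i" "(0 :: real ^ 'n) \<in> neg_face i"
      by (simp_all add: pos_face_def neg_face_def unit_cube_def)
    then show "?Q - U i \<noteq> {}" "?Q - V i \<noteq> {}"
      using neg[of i] pos[of i] disj[of i] UV_subset[of i] by blast+
  qed
  define h where "h x i = infdist x (?Q - U i) - infdist x (?Q - V i)" for x i
  define f where "f x = (\<chi> i. x $ i + h x i)" for x
  have "continuous_on ?Q f"
    unfolding f_def h_def by (intro continuous_intros)
  moreover have "f \<in> ?Q \<rightarrow> ?Q"
  proof
    fix x assume "x \<in> ?Q"
    have "0 \<le> x $ i + h x i" "x $ i + h x i \<le> 1" for i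
      using pos_le[OF \<open>x \<in> ?Q\<close>, of i] neg_le[OF \<open>x \<in> ?Q\<close>, of i]
        infdist_nonneg[of x "?Q - U i"] infdist_nonneg[of x "?Q - V i"]
      by (auto simp: h_def)
    then show "f x \<in> ?Q"
      by (simp add: f_def unit_cube_def)
  qed
  moreover have "compact ?Q" "convex ?Q" "?Q \<noteq> {}"
    using compl_nonempty by (auto simp: unit_cube_eq_cbox)
  ultimately obtain x where "x \<in> ?Q" and "f x = x"
    using brouwer by metis
  have "x \<in> C i" for i
  proof (rule ccontr)
    assume "x \<notin> C i"
    have "h x i = 0"
      using \<open>f x = x\<close> by (metis add_cancel_left_right f_def vec_lambda_beta)
    from \<open>x \<notin> C i\<close> \<open>x \<in> ?Q\<close> split[of i] consider "x \<in> U i" | "x \<in> V i"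
      by blast
    then show False
    proof cases
      case 1
      \<comment> \<open>A point of \<open>U i\<close> is outside \<open>V i\<close>, so
        \<open>h x i\<close> reduces to its first distance, which is positive.\<close>
      then have "infdist x (?Q - V i) = 0"
        using disj[of i] \<open>x \<in> ?Q\<close> by (intro infdist_zero) auto
      with \<open>h x i = 0\<close> infdist_pos_if_openin[OF U 1 compl_nonempty(1)] show False
        by (simp add: h_def)
    next
      case 2
      then have "infdist x (?Q - U i) = 0"
        using disj[of i] \<open>x \<in> ?Q\<close> by (intro infdist_zero) auto
      with \<open>h x i = 0\<close> infdist_pos_if_openin[OF V 2 compl_nonempty(2)] show False
        by (simp add: h_def)
    qed
  qed
  then show ?thesis by blast
qed

end
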